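(* Let $p,q\in\mathbb{R}[x]$ be real polynomials and let $\alpha\ge 0$ be a real number. Then $$Z_C\big(q(x)p'(x)+\alpha q'(x)p(x)\big)\le Z_C(p(x))+Z_C(q(x)).$$ In particular, if $q$ has only real zeros, then the operator $q(x)D+\alpha q'(x)I$ on $\mathbb{R}[x]$ is a complex zero decreasing operator (CZDO).
   Context: For a non-zero function $f$, $Z_C(f)$ denotes the number of non-real zeros of $f$ in $\mathbb{C}$, counted according to multiplicity; for the identically zero function, $Z_C(0)=0$. $D$ denotes differentiation, $D(p)=p'$, and $I$ the identity operator. A linear operator $L:\mathbb{R}[x]\to\mathbb{R}[x]$ is a complex zero decreasing operator (CZDO) if $Z_C(L(p))\le Z_C(p)$ for every real polynomial $p$. *)

theory Defs
  imports Complex_Main "HOL-Computational_Algebra.Computational_Algebra"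
begin

definition ZC :: "real poly \<Rightarrow> nat" where
  "ZC p = (if p = 0 then 0
     else (\<Sum>z | poly (map_poly complex_of_real p) z = 0 \<and> z \<notin> \<real>.
             order z (map_poly complex_of_real p)))"

text \<open>Linearity is over the reals: \<open>smult\<close> is the scalar multiplication on both sides.\<close>

definition CZDO :: "(real poly \<Rightarrow> real poly) \<Rightarrow> bool" where
  "CZDO L \<longleftrightarrow> Vector_Spaces.linear smult smult L \<and> (\<forall>p. ZC (L p) \<le> ZC p)"

text \<open>The zero polynomial does not satisfy the next predicate: every complex number is a zero of it.\<close>

definition only_real_zeros :: "real poly \<Rightarrow> bool" where
  "only_real_zeros q \<longleftrightarrow> (\<forall>z. poly (map_poly complex_of_real q) z = 0 \<longrightarrow> z \<in> \<real>)"

end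

theory Submission
  imports Defs
begin

text \<open>
  Put \<open>h = q p' + \<alpha> q' p\<close>. Suppose \<open>\<alpha> > 0\<close> and \<open>h \<noteq> 0\<close>. Away from the zeros of \<open>q\<close>, the
  derivative of \<open>\<bar>q\<bar>\<^sup>\<alpha> p\<close> is \<open>h\<close> times a nonvanishing factor, and \<open>\<bar>q\<bar>\<^sup>\<alpha> p\<close> vanishes at every real zero of \<open>p q\<close>.
  Rolle's theorem therefore gives a zero of \<open>h\<close> strictly between any two neighbouring real zeros
  of \<open>p q\<close> (\<open>zero_between_neighbouring_zeros\<close>), while at a zero of \<open>p q\<close> of multiplicity \<open>m\<close> the
  polynomial \<open>h\<close> vanishes to order at least \<open>m - 1\<close> (\<open>order_mult_le_order_combination\<close>). If \<open>p q\<close>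
  has \<open>k \<ge> 1\<close> distinct real zeros, and \<open>R\<close> of them with multiplicity, then \<open>h\<close> has at least
  \<open>(R - k) + (k - 1) = R - 1\<close> real zeros. The degree of \<open>h\<close> is at most that of \<open>p q\<close> minus one,
  and a real polynomial has as many nonreal zeros as its degree exceeds its number of real zeros
  (\<open>ZC_plus_size_proots\<close>); so passing from \<open>p q\<close> to \<open>h\<close> does not increase the number of nonreal
  zeros.

  For \<open>\<alpha> = 0\<close> the function \<open>\<bar>q\<bar>\<^sup>\<alpha> p\<close> need not vanish at the zeros of \<open>q\<close>. There \<open>h = q p'\<close>, and it is
  enough to know that \<open>p'\<close> has no more nonreal zeros than \<open>p\<close>, which is the case \<open>\<alpha> = 1\<close>, \<open>q = 1\<close>
  of the previous argument.
\<close>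

section \<open>Counting zeros of real polynomials in the complex plane\<close>

lemma map_poly_complex_of_real_mult:
  "map_poly complex_of_real (p * q) = map_poly complex_of_real p * map_poly complex_of_real q"
  by (rule poly_eqI) (simp add: coeff_map_poly coeff_mult)

lemma map_poly_complex_of_real_power:
  "map_poly complex_of_real (p ^ n) = map_poly complex_of_real p ^ n"
  by (induction n) (simp_all add: map_poly_complex_of_real_mult map_poly_1)

lemma map_poly_complex_of_real_eq_0_iff [simp]:
  "map_poly complex_of_real p = 0 \<longleftrightarrow> p = 0"
  by (simp add: map_poly_eq_0_iff)

lemma poly_map_poly_complex_of_real:
  "poly (map_poly complex_of_real p) (complex_of_real x) = complex_of_real (poly p x)"
  by (induction p) (simp_all add: map_poly_pCons)

lemma order_map_poly_complex_of_real:
  assumes "p \<noteq> 0"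
  shows "order (complex_of_real x) (map_poly complex_of_real p) = order x p"
proof -
  let ?C = "map_poly complex_of_real"
  obtain r where r: "p = [:-x, 1:] ^ order x p * r" "\<not> [:-x, 1:] dvd r"
    using order_decomp[OF assms] by blast
  have "poly (?C r) (complex_of_real x) \<noteq> 0"
    using r(2) by (simp add: poly_map_poly_complex_of_real poly_eq_0_iff_dvd)
  hence 0: "order (complex_of_real x) (?C r) = 0"
    by (rule order_0I)
  have lin: "?C [:-x, 1:] = [:-complex_of_real x, 1:]"
    by (simp add: map_poly_pCons)
  have C: "?C p = [:-complex_of_real x, 1:] ^ order x p * ?C r"
    by (subst r(1)) (simp only: map_poly_complex_of_real_mult map_poly_complex_of_real_power lin)
  moreover have "?C p \<noteq> 0"
    using assms by simp
  ultimately have "order (complex_of_real x) (?C p) =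
      order (complex_of_real x) ([:-complex_of_real x, 1:] ^ order x p)
      + order (complex_of_real x) (?C r)"
    using order_mult by metis
  thus ?thesis
    by (simp add: 0 order_power_n_n)
qed

lemma ZC_eq_size_filter_proots:
  "ZC p = size (filter_mset (\<lambda>z. z \<notin> \<real>) (proots (map_poly complex_of_real p)))"
proof (cases "p = 0")
  case False
  let ?P = "map_poly complex_of_real p"
  have "set_mset (filter_mset (\<lambda>z. z \<notin> \<real>) (proots ?P)) = {z. poly ?P z = 0 \<and> z \<notin> \<real>}"
    using False by auto
  thus ?thesis
    using False by (simp add: ZC_def size_multiset_overloaded_eq)
qed (simp add: ZC_def)

lemma filter_proots_Reals:
  "filter_mset (\<lambda>z. z \<in> \<real>) (proots (map_poly complex_of_real p))
     = image_mset complex_of_real (proots p)"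
proof (cases "p = 0")
  case False
  have inj: "count (image_mset complex_of_real (proots p)) (complex_of_real x) = count (proots p) x"
    for x
    by (simp add: count_image_mset' Collect_conv_if Collect_conv_if2 not_in_iff del: set_count_proots)
  show ?thesis
  proof (rule multiset_eqI)
    fix z :: complex
    show "count (filter_mset (\<lambda>z. z \<in> \<real>) (proots (map_poly complex_of_real p))) z
        = count (image_mset complex_of_real (proots p)) z"
    proof (cases "z \<in> \<real>")
      case True
      then obtain x where "z = complex_of_real x"
        by (rule Reals_cases)
      thus ?thesis
        using False by (simp add: inj order_map_poly_complex_of_real)
    next
      case z: False
      hence "z \<notin># image_mset complex_of_real (proots p)"
        by auto
      thus ?thesis
        using z by (simp add: count_eq_zero_iff del: in_image_mset)
    qed
  qed
qed simp

text \<open>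
  The fundamental theorem of algebra in the form in which it enters below: nonreal zeros are
  counted by counting the real ones.
\<close>

lemma ZC_plus_size_proots: "ZC p + size (proots p) = degree p"
proof -
  let ?M = "proots (map_poly complex_of_real p)"
  have "degree p = size ?M"
    by (simp add: size_proots_complex degree_map_poly)
  also have "?M = filter_mset (\<lambda>z. z \<in> \<real>) ?M + filter_mset (\<lambda>z. z \<notin> \<real>) ?M"
    by (rule multiset_partition)
  also have "size \<dots> = size (proots p) + ZC p"
    by (simp only: size_union filter_proots_Reals size_image_mset ZC_eq_size_filter_proots)
  finally show ?thesis
    by simp
qed

lemma ZC_mult:
  assumes "p \<noteq> 0" "q \<noteq> 0"
  shows "ZC (p * q) = ZC p + ZC q"
  using ZC_plus_size_proots[of p] ZC_plus_size_proots[of q] ZC_plus_size_proots[of "p * q"] assms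
  by (simp add: proots_mult degree_mult_eq)

lemma ZC_eq_0_if_only_real_zeros:
  assumes "only_real_zeros q"
  shows "ZC q = 0"
  using assms by (auto simp: ZC_def only_real_zeros_def intro!: sum.neutral)

section \<open>Zeros between neighbouring points of a finite set\<close>

text \<open>
  Sending each point of \<open>S\<close> other than the largest to an element of \<open>T\<close> in the gap to its right is
  injective, because these gaps are disjoint.
\<close>

lemma card_le_Suc_card_if_interleaving:
  fixes S T :: "'a :: linorder set"
  assumes fin: "finite S" "finite T"
    and gap: "\<And>a b. a \<in> S \<Longrightarrow> b \<in> S \<Longrightarrow> a < b \<Longrightarrow> {a<..<b} \<inter> S = {} \<Longrightarrow> {a<..<b} \<inter> T \<noteq> {}"
  shows "card S \<le> Suc (card T)"
proof (cases "S = {}")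
  case False
  let ?S = "S - {Max S}"
  have "\<exists>t\<in>T. a < t \<and> (\<forall>b\<in>S. a < b \<longrightarrow> t < b)" if a: "a \<in> ?S" for a
  proof -
    define b where "b = Min {y \<in> S. a < y}"
    have "Max S \<in> S"
      using False fin(1) by (rule Max_in[rotated])
    moreover have "a < Max S"
      using a fin(1) by (simp add: order.not_eq_order_implies_strict)
    ultimately have ne: "{y \<in> S. a < y} \<noteq> {}"
      by blast
    have b: "b \<in> S" "a < b" and least: "\<And>y. y \<in> S \<Longrightarrow> a < y \<Longrightarrow> b \<le> y"
      using Min_in[OF _ ne] fin(1) by (auto simp: b_def)
    have "{a<..<b} \<inter> S = {}"
      using least by force
    then obtain t where "t \<in> T" "a < t" "t < b"
      using gap[of a b] a b by auto
    thus ?thesis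
      using least by (meson order.strict_trans2)
  qed
  then obtain f where f: "\<And>a. a \<in> ?S \<Longrightarrow> f a \<in> T \<and> a < f a \<and> (\<forall>b\<in>S. a < b \<longrightarrow> f a < b)"
    by metis
  have "inj_on f ?S"
  proof (rule linorder_inj_onI)
    fix x y assume xy: "x < y" "x \<in> ?S" "y \<in> ?S"
    hence "f x < y" "y < f y"
      using f by auto
    thus "f x \<noteq> f y"
      by order
  qed auto
  hence "card ?S \<le> card T"
    using f fin(2) by (intro card_inj_on_le[of f]) auto
  thus ?thesis
    using False fin(1) by simp
qed simp

section \<open>The real zeros of the combination\<close>

lemma power_linear_dvd_pderiv:
  fixes p :: "real poly"
  shows "[:-x, 1:] ^ (order x p - 1) dvd pderiv p"
proof -
  obtain r where r: "p = [:-x, 1:] ^ order x p * r"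
    using order_1 by (metis dvdE)
  show ?thesis
  proof (cases "order x p")
    case (Suc n)
    have "pderiv p = [:-x, 1:] ^ Suc n * pderiv r + r * pderiv ([:-x, 1:] ^ Suc n)"
      by (subst r) (simp only: Suc pderiv_mult)
    also have "[:-x, 1:] ^ n dvd \<dots>"
      unfolding pderiv_power_Suc by (intro dvd_add) (simp_all add: dvd_smult del: mult_pCons_left)
    finally show ?thesis
      by (simp add: Suc)
  qed simp
qed

text \<open>
  Each summand of the combination carries one derivative, and a derivative costs at most one power
  of a linear factor.
\<close>

lemma order_mult_le_order_combination:
  fixes p q :: "real poly"
  assumes h: "q * pderiv p + smult \<alpha> (pderiv q * p) \<noteq> 0"
  shows "order x (p * q) - 1 \<le> order x (q * pderiv p + smult \<alpha> (pderiv q * p))"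
proof -
  have dvd: "[:-x, 1:] ^ (order x u + order x v - 1) dvd u * pderiv v" for u v :: "real poly"
  proof -
    have "[:-x, 1:] ^ (order x u + order x v - 1) dvd [:-x, 1:] ^ (order x u + (order x v - 1))"
      by (rule le_imp_power_dvd) simp
    also have "\<dots> dvd u * pderiv v"
      unfolding power_add by (intro mult_dvd_mono order_1 power_linear_dvd_pderiv)
    finally show ?thesis .
  qed
  have pq: "p * q \<noteq> 0"
    using h by auto
  have "[:-x, 1:] ^ (order x q + order x p - 1) dvd q * pderiv p + smult \<alpha> (pderiv q * p)"
    using dvd[of q p] dvd[of p q] by (intro dvd_add dvd_smult) (simp_all add: ac_simps)
  thus ?thesis
    using h pq by (simp add: order_divides order_mult add.commute)
qed

text \<open>
  Rolle's theorem for \<open>\<bar>q\<bar>\<^sup>\<alpha> p\<close>, written as \<open>(q\<^sup>2)\<^sup>\<beta> p\<close> with \<open>\<beta> = \<alpha> / 2\<close> so that the base of the power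
  is nonnegative and differentiable whatever the sign of \<open>q\<close>. Positivity of \<open>\<alpha>\<close> makes this function
  continuous, and zero, also at an end point where \<open>q\<close> vanishes.
\<close>

lemma zero_between_neighbouring_zeros:
  fixes p q :: "real poly"
  assumes \<alpha>: "\<alpha> > 0" and ab: "a < b"
    and ends: "poly (p * q) a = 0" "poly (p * q) b = 0"
    and no_zero: "\<And>x. a < x \<Longrightarrow> x < b \<Longrightarrow> poly q x \<noteq> 0"
  shows "\<exists>x. a < x \<and> x < b \<and> poly (q * pderiv p + smult \<alpha> (pderiv q * p)) x = 0"
proof -
  define \<beta> where "\<beta> = \<alpha> / 2"
  have \<alpha>_eq: "\<alpha> = 2 * \<beta>" and \<beta>: "\<beta> > 0"
    using \<alpha> by (simp_all add: \<beta>_def)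
  define f where "f = (\<lambda>x. ((poly q x)\<^sup>2) powr \<beta> * poly p x)"
  have der: "(f has_real_derivative
      ((poly q x)\<^sup>2) powr (\<beta> - 1) * poly q x * poly (q * pderiv p + smult \<alpha> (pderiv q * p)) x) (at x)"
    if x: "a < x" "x < b" for x
  proof -
    have pos: "(poly q x)\<^sup>2 > 0"
      using no_zero[OF x] by simp
    hence "((poly q x)\<^sup>2) powr \<beta> = ((poly q x)\<^sup>2) powr (\<beta> - 1) * (poly q x)\<^sup>2"
      by (simp add: powr_diff)
    moreover have "((\<lambda>x. ((poly q x)\<^sup>2) powr \<beta>) has_real_derivative
        \<beta> * ((poly q x)\<^sup>2) powr (\<beta> - 1) * (2 * poly q x * poly (pderiv q) x)) (at x)"
      using DERIV_fun_powr[of "\<lambda>x. (poly q x)\<^sup>2" "2 * poly q x * poly (pderiv q) x" x \<beta>] pos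
      by (auto intro!: derivative_eq_intros)
    ultimately show ?thesis
      unfolding f_def
      by (auto intro!: DERIV_mult[THEN DERIV_cong] poly_DERIV
          simp: \<alpha>_eq algebra_simps power2_eq_square)
  qed
  have "f a = f b"
    using ends by (auto simp: f_def)
  moreover have "continuous_on {a..b} f"
    unfolding f_def using \<beta> by (intro continuous_intros continuous_on_powr') auto
  moreover have "f differentiable (at x)" if "a < x" "x < b" for x
    using der[OF that] real_differentiable_def by blast
  ultimately obtain z where z: "a < z" "z < b" "(f has_real_derivative 0) (at z)"
    using Rolle[OF ab, of f] by blast
  have "((poly q z)\<^sup>2) powr (\<beta> - 1) * poly q z * poly (q * pderiv p + smult \<alpha> (pderiv q * p)) z = 0"
    using DERIV_unique[OF der z(3)] z by blast
  hence "poly (q * pderiv p + smult \<alpha> (pderiv q * p)) z = 0"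
    using no_zero[OF z(1,2)] by (simp del: poly_add poly_mult poly_smult)
  thus ?thesis
    using z(1,2) by blast
qed

lemma size_proots_mult_le_combination:
  fixes p q :: "real poly"
  assumes \<alpha>: "\<alpha> > 0" and h0: "q * pderiv p + smult \<alpha> (pderiv q * p) \<noteq> 0"
  shows "size (proots (p * q)) \<le> Suc (size (proots (q * pderiv p + smult \<alpha> (pderiv q * p))))"
proof -
  define h where "h = q * pderiv p + smult \<alpha> (pderiv q * p)"
  define S where "S = {x. poly (p * q) x = 0}"
  define T where "T = {x. poly h x = 0} - S"
  have ne: "h \<noteq> 0" "p * q \<noteq> 0"
    using h0 by (auto simp: h_def)
  hence fin: "finite S" "finite T"
    unfolding S_def T_def by (auto intro!: poly_roots_finite simp del: poly_mult)
  have "card S \<le> Suc (card T)"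
  proof (rule card_le_Suc_card_if_interleaving[OF fin])
    fix a b assume ab: "a \<in> S" "b \<in> S" "a < b" "{a<..<b} \<inter> S = {}"
    have "poly q x \<noteq> 0" if "a < x" "x < b" for x
      using that ab(4) by (auto simp: S_def)
    then obtain x where "a < x" "x < b" "poly h x = 0"
      using zero_between_neighbouring_zeros[OF \<alpha>, of a b p q] ab(1-3)
      unfolding S_def h_def by blast
    hence "x \<in> {a<..<b} \<inter> T"
      using ab(4) by (auto simp: T_def simp del: poly_mult)
    thus "{a<..<b} \<inter> T \<noteq> {}"
      by blast
  qed
  moreover have sub: "mset_set S \<subseteq># proots (p * q)"
    using ne(2) fin by (intro mset_subset_eqI)
      (auto simp: count_mset_set' S_def Suc_le_eq order_gt_0_iff simp del: poly_mult)
  moreover have "proots (p * q) - mset_set S + mset_set T \<subseteq># proots h"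
  proof (rule mset_subset_eqI)
    fix x
    \<comment> \<open>The two parts live on disjoint sets: the first is supported on \<open>S\<close>, the second on \<open>T\<close>.\<close>
    consider "x \<in> S" | "x \<in> T" | "x \<notin> S" "x \<notin> T"
      by blast
    thus "count (proots (p * q) - mset_set S + mset_set T) x \<le> count (proots h) x"
    proof cases
      case 1
      moreover have "x \<notin> T"
        using 1 by (simp add: T_def)
      ultimately show ?thesis
        using ne fin order_mult_le_order_combination[OF h0, of x]
        by (simp add: count_mset_set' h_def)
    next
      case 2
      hence "x \<notin> S" "order x h > 0"
        using ne by (auto simp: T_def order_gt_0_iff)
      moreover have "order x (p * q) = 0"
        using \<open>x \<notin> S\<close> by (intro order_0I) (simp add: S_def)
      ultimately show ?thesis
        using 2 ne fin by (simp add: count_mset_set')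
    next
      case 3
      moreover have "order x (p * q) = 0"
        using \<open>x \<notin> S\<close> by (intro order_0I) (simp add: S_def)
      ultimately show ?thesis
        using ne by (simp add: count_mset_set')
    qed
  qed
  hence "size (proots (p * q) - mset_set S) + card T \<le> size (proots h)"
    using size_mset_mono by fastforce
  ultimately show ?thesis
    unfolding h_def[symmetric] using size_Diff_submset[OF sub] by simp
qed

section \<open>Comparing the numbers of nonreal zeros\<close>

lemma degree_combination_less:
  fixes p q :: "real poly"
  assumes h: "q * pderiv p + smult \<alpha> (pderiv q * p) \<noteq> 0"
  shows "degree (q * pderiv p + smult \<alpha> (pderiv q * p)) < degree (p * q)"
proof -
  have pq: "p \<noteq> 0" "q \<noteq> 0"
    using h by auto
  have pos: "degree (p * q) > 0"
  proof (rule ccontr)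
    assume "\<not> ?thesis"
    hence "pderiv p = 0" "pderiv q = 0"
      using pq by (simp_all add: degree_mult_eq pderiv_eq_0_iff)
    thus False
      using h by simp
  qed
  have "degree (u * pderiv v) < degree (p * q)" if "degree u + degree v = degree (p * q)"
    for u v :: "real poly"
  proof (cases "degree v = 0")
    case True
    thus ?thesis
      using pos pderiv_eq_0_iff[of v] by simp
  next
    case False
    thus ?thesis
      using that degree_mult_le[of u "pderiv v"] by (simp add: degree_pderiv)
  qed
  hence "degree (q * pderiv p) < degree (p * q)" "degree (p * pderiv q) < degree (p * q)"
    using pq by (simp_all add: degree_mult_eq)
  thus ?thesis
    by (intro degree_add_less le_less_trans[OF degree_smult_le]) (simp_all add: mult.commute)
qed

lemma ZC_combination_le_if_pos:
  fixes p q :: "real poly"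
  assumes \<alpha>: "\<alpha> > 0"
  shows "ZC (q * pderiv p + smult \<alpha> (pderiv q * p)) \<le> ZC p + ZC q"
proof (cases "q * pderiv p + smult \<alpha> (pderiv q * p) = 0")
  case True
  thus ?thesis
    by (simp add: ZC_def)
next
  case False
  hence "p \<noteq> 0" "q \<noteq> 0"
    by auto
  hence "ZC (p * q) = ZC p + ZC q"
    by (rule ZC_mult)
  thus ?thesis
    using size_proots_mult_le_combination[OF \<alpha> False] degree_combination_less[OF False]
      ZC_plus_size_proots[of "p * q"]
      ZC_plus_size_proots[of "q * pderiv p + smult \<alpha> (pderiv q * p)"]
    by linarith
qed

lemma ZC_pderiv_le: "ZC (pderiv p) \<le> ZC p"
  using ZC_combination_le_if_pos[of 1 1 p] ZC_plus_size_proots[of 1] by simp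

lemma ZC_combination_le:
  fixes p q :: "real poly"
  assumes "\<alpha> \<ge> 0"
  shows "ZC (q * pderiv p + smult \<alpha> (pderiv q * p)) \<le> ZC p + ZC q"
proof (cases "\<alpha> = 0")
  case False
  thus ?thesis
    using assms by (intro ZC_combination_le_if_pos) simp
next
  case True
  show ?thesis
  proof (cases "q * pderiv p = 0")
    case False
    hence "ZC (q * pderiv p) = ZC q + ZC (pderiv p)"
      by (intro ZC_mult) auto
    thus ?thesis
      using True ZC_pderiv_le[of p] by simp
  next
    case zero: True
    thus ?thesis
      using True by (simp add: ZC_def)
  qed
qed

theorem theorem8:
  fixes p q :: "real poly" and \<alpha> :: real
  assumes "\<alpha> \<ge> 0"
  shows "ZC (q * pderiv p + smult \<alpha> (pderiv q * p)) \<le> ZC p + ZC q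
    \<and> (only_real_zeros q \<longrightarrow> CZDO (\<lambda>r. q * pderiv r + smult \<alpha> (pderiv q) * r))"
proof (intro conjI impI)
  show "ZC (q * pderiv p + smult \<alpha> (pderiv q * p)) \<le> ZC p + ZC q"
    by (rule ZC_combination_le[OF assms])
next
  assume q: "only_real_zeros q"
  have "Vector_Spaces.linear smult smult (\<lambda>r. q * pderiv r + smult \<alpha> (pderiv q) * r)"
    by unfold_locales
      (simp_all add: pderiv_add pderiv_smult algebra_simps smult_add_left smult_add_right)
  moreover have "ZC (q * pderiv r + smult \<alpha> (pderiv q) * r) \<le> ZC r" for r
    using ZC_combination_le[OF assms, of q r] ZC_eq_0_if_only_real_zeros[OF q] by simp
  ultimately show "CZDO (\<lambda>r. q * pderiv r + smult \<alpha> (pderiv q) * r)"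
    by (simp add: CZDO_def)
qed

end
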